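(* Let $(X,Y,\pi,\nu)$ be a factor quadruple with finite degree $d$. If $\lambda$ and $\lambda'$ are degree joinings over $\nu$ with respect to $\pi$, then there is a permutation $f$ of $\{1,\dots,d\}$ such that $\lambda'=p_f\lambda$, and therefore also $\lambda=p_{f^{-1}}\lambda'$, where for a permutation $g$ of $\{1,\dots,d\}$ the map $p_g:X^d\to X^d$ is given by $p_g(x_1,\dots,x_d)=(x_{g(1)},\dots,x_{g(d)})$.
   Context: A topological dynamical system $(X,T)$ is a compact metric space $X$ with a homeomorphism $T:X\to X$. "Measure" means Borel probability measure; $E(X)=E(X,T)$ is the set of ergodic $T$-invariant measures. A factor map $\pi:(X,T)\to(Y,S)$ is a continuous surjection with $\pi\circ T=S\circ\pi$. For a measure $\mu$ on $X$, $\pi\mu$ denotes the pushforward $\mu\circ\pi^{-1}$ (similarly for other maps such as $p_g$). A factor quadruple $(X,Y,\pi,\nu)$ consists of a factor map $\pi:(X,T)\to(Y,S)$ between topological dynamical systems and $\nu\in E(Y,S)$. The function $y\mapsto|\pi^{-1}(y)|\in\{1,2,\dots\}\cup\{\infty\}$ is $\nu$-a.e. constant; the constant is the degree $d_{\pi,\nu}$ of the quadruple. $X^n$ carries the product action $T\times\cdots\times T$, and $p_i:X^n\to X$ is the $i$-th coordinate projection. The fiber product is $X^n_\pi=\{(x_1,\dots,x_n)\in X^n:\pi(x_1)=\cdots=\pi(x_n)\}$. An $n$-fold $\pi$-relative joining is an invariant measure $\lambda$ on $X^n$ with $\lambda(X^n_\pi)=1$; it is over $\nu$ if $\pi p_i\lambda=\nu$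 for some (equivalently all) $i$. It is separating if for $\lambda$-a.e. $(x_1,\dots,x_n)$ the points $x_1,\dots,x_n$ are pairwise distinct. If $d=d_{\pi,\nu}<\infty$, a degree joining over $\nu$ with respect to $\pi$ is a $d$-fold ergodic separating $\pi$-relative joining over $\nu$ (a measure on $X^d$). *)

theory Defs
  imports "HOL-Probability.Probability" "HOL-Library.Extended_Nat"
begin

(* Compact metric spaces are whole types of class metric_space with compact UNIV. *)
definition top_dyn_sys :: "('a::metric_space \<Rightarrow> 'a) \<Rightarrow> bool" where
  "top_dyn_sys T \<longleftrightarrow> compact (UNIV :: 'a set) \<and> (\<exists>T'. homeomorphism UNIV UNIV T T')"

definition factor_map ::
  "('a::metric_space \<Rightarrow> 'a) \<Rightarrow> ('b::metric_space \<Rightarrow> 'b) \<Rightarrow> ('a \<Rightarrow> 'b) \<Rightarrow> bool" where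
  "factor_map T S \<pi> \<longleftrightarrow>
     top_dyn_sys T \<and> top_dyn_sys S \<and> continuous_on UNIV \<pi> \<and> surj \<pi> \<and> \<pi> \<circ> T = S \<circ> \<pi>"

(* N only supplies the underlying measurable space; its measure is irrelevant. *)
definition invariant_measures :: "'c measure \<Rightarrow> ('c \<Rightarrow> 'c) \<Rightarrow> 'c measure set" where
  "invariant_measures N T =
     {\<mu>. sets \<mu> = sets N \<and> prob_space \<mu> \<and> T \<in> measurable N N \<and> distr \<mu> N T = \<mu>}"

definition ergodic_measures :: "'c measure \<Rightarrow> ('c \<Rightarrow> 'c) \<Rightarrow> 'c measure set" where
  "ergodic_measures N T =
     {\<mu> \<in> invariant_measures N T.
        \<forall>A\<in>sets N. T -` A \<inter> space N = A \<longrightarrow> emeasure \<mu> A = 0 \<or> emeasure \<mu> A = 1}"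

definition factor_quadruple ::
  "('a::metric_space \<Rightarrow> 'a) \<Rightarrow> ('b::metric_space \<Rightarrow> 'b) \<Rightarrow> ('a \<Rightarrow> 'b) \<Rightarrow> 'b measure \<Rightarrow> bool" where
  "factor_quadruple T S \<pi> \<nu> \<longleftrightarrow> factor_map T S \<pi> \<and> \<nu> \<in> ergodic_measures borel S"

definition ecard :: "'c set \<Rightarrow> enat" where
  "ecard A = (if finite A then enat (card A) else \<infinity>)"

(* The almost everywhere constant value of the fibre cardinality. For a factor quadruple
   this value exists, because the fibre cardinality is measurable and S-invariant. *)
definition fiber_degree :: "('a \<Rightarrow> 'b) \<Rightarrow> 'b measure \<Rightarrow> enat" where
  "fiber_degree \<pi> \<nu> = (THE k. AE y in \<nu>. ecard (\<pi> -` {y}) = k)"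

lemma fiber_degree_eqI:
  assumes "prob_space \<nu>" and "AE y in \<nu>. ecard (\<pi> -` {y}) = k"
  shows "fiber_degree \<pi> \<nu> = k"
  unfolding fiber_degree_def
proof (rule the_equality)
  fix l assume "AE y in \<nu>. ecard (\<pi> -` {y}) = l"
  with assms(2) have "AE y in \<nu>. l = k" by eventually_elim simp
  then show "l = k" using prob_space.AE_const[OF assms(1)] by simp
qed (fact assms(2))

(* The n-th power, with points as extensional functions on {1..n}. A compact metric space
   is second countable, so the product of the Borel sigma-algebras is the Borel
   sigma-algebra of the power. *)
abbreviation power_space :: "nat \<Rightarrow> (nat \<Rightarrow> 'a::metric_space) measure" where
  "power_space n \<equiv> PiM {1..n} (\<lambda>_. borel)"

definition power_map :: "nat \<Rightarrow> ('a \<Rightarrow> 'a) \<Rightarrow> (nat \<Rightarrow> 'a) \<Rightarrow> (nat \<Rightarrow> 'a)" where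
  "power_map n T x = (\<lambda>i\<in>{1..n}. T (x i))"

definition coord_perm :: "nat \<Rightarrow> (nat \<Rightarrow> nat) \<Rightarrow> (nat \<Rightarrow> 'a) \<Rightarrow> (nat \<Rightarrow> 'a)" where
  "coord_perm n g x = (\<lambda>i\<in>{1..n}. x (g i))"

definition fiber_product :: "nat \<Rightarrow> ('a \<Rightarrow> 'b) \<Rightarrow> (nat \<Rightarrow> 'a) set" where
  "fiber_product n \<pi> =
     {x \<in> {1..n} \<rightarrow>\<^sub>E UNIV. \<forall>i\<in>{1..n}. \<forall>j\<in>{1..n}. \<pi> (x i) = \<pi> (x j)}"

definition relative_joining ::
  "nat \<Rightarrow> ('a::metric_space \<Rightarrow> 'a) \<Rightarrow> ('a \<Rightarrow> 'b) \<Rightarrow> (nat \<Rightarrow> 'a) measure \<Rightarrow> bool" where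
  "relative_joining n T \<pi> M \<longleftrightarrow>
     M \<in> invariant_measures (power_space n) (power_map n T) \<and>
     emeasure M (fiber_product n \<pi>) = 1"

definition joining_over ::
  "nat \<Rightarrow> ('a::metric_space \<Rightarrow> 'b::metric_space) \<Rightarrow> 'b measure \<Rightarrow> (nat \<Rightarrow> 'a) measure \<Rightarrow> bool" where
  "joining_over n \<pi> \<nu> M \<longleftrightarrow> (\<exists>i\<in>{1..n}. distr (distr M borel (\<lambda>x. x i)) borel \<pi> = \<nu>)"

definition separating :: "nat \<Rightarrow> (nat \<Rightarrow> 'a) measure \<Rightarrow> bool" where
  "separating n M \<longleftrightarrow> (AE x in M. inj_on x {1..n})"

definition degree_joining ::
  "nat \<Rightarrow> ('a::metric_space \<Rightarrow> 'a) \<Rightarrow> ('a \<Rightarrow> 'b::metric_space) \<Rightarrow> 'b measure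
     \<Rightarrow> (nat \<Rightarrow> 'a) measure \<Rightarrow> bool" where
  "degree_joining d T \<pi> \<nu> M \<longleftrightarrow>
     fiber_degree \<pi> \<nu> = enat d \<and>
     relative_joining d T \<pi> M \<and> joining_over d \<pi> \<nu> M \<and> separating d M \<and>
     M \<in> ergodic_measures (power_space d) (power_map d T)"

end

theory Submission
  imports Defs
begin

text \<open>
  Almost every fibre has exactly \<open>d\<close> points, so for \<open>L\<close>-almost every \<open>x\<close> the permuted tuples
  \<open>coord_perm d f x\<close> run through all enumerations of the fibre below \<open>x\<close>. Hence the sum of the
  images of \<open>L\<close> under all coordinate permutations gives a closed rectangle \<open>R\<close> the integral over
  \<open>\<nu>\<close> of the number of enumerations in \<open>R\<close>, which no longer depends on \<open>L\<close>; the sums for \<open>L\<close> and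
  \<open>L'\<close> therefore coincide, and \<open>L'\<close> is dominated by the sum for \<open>L\<close>. All summands are ergodic,
  and distinct ergodic measures are mutually singular, so \<open>L'\<close> must be one of them.
\<close>

section \<open>Invariant measures and the mutual singularity of ergodic ones\<close>

lemma invariant_measures_emeasure:
  assumes "\<mu> \<in> invariant_measures N T" "A \<in> sets N"
  shows "emeasure \<mu> (T -` A \<inter> space N) = emeasure \<mu> A"
proof -
  have sets: "sets \<mu> = sets N" and T: "T \<in> measurable N N" and inv: "distr \<mu> N T = \<mu>"
    using assms(1) by (auto simp: invariant_measures_def)
  have "T \<in> measurable \<mu> N"
    using T sets by (metis measurable_cong_sets)
  with emeasure_distr[of T \<mu> N A] show ?thesis
    using assms(2) sets inv sets_eq_imp_space_eq[OF sets] by simp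
qed

text \<open>Starting from a Hahn set \<open>A\<close>, which maximises the difference, the union \<open>U\<close> of the preimages of
  \<open>A\<close> and then the intersection of the decreasing preimages of \<open>U\<close> are still maximisers.\<close>

lemma exists_invariant_maximal_difference:
  assumes M: "M \<in> invariant_measures N T" and M': "M' \<in> invariant_measures N T"
  obtains C where "C \<in> sets N" "T -` C \<inter> space N = C"
    "\<And>B. B \<in> sets N \<Longrightarrow> measure M' B - measure M B \<le> measure M' C - measure M C"
proof -
  have sM [simp]: "sets M = sets N" "sets M' = sets N" and T [measurable]: "T \<in> measurable N N"
    and p: "prob_space M" "prob_space M'"
    using M M' by (auto simp: invariant_measures_def)
  interpret M: prob_space M by fact
  interpret M': prob_space M' by fact
  define s where "s B = measure M' B - measure M B" for B
  define pre where "pre B = T -` B \<inter> space N" for B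
  have pre_sets: "pre B \<in> sets N" if "B \<in> sets N" for B
    using that by (simp add: pre_def)
  have s_pre: "s (pre B) = s B" if "B \<in> sets N" for B
    using invariant_measures_emeasure[OF M that] invariant_measures_emeasure[OF M' that]
    by (simp add: s_def pre_def measure_def)
  have sub: "B \<subseteq> space N" if "B \<in> sets N" for B
    using that sets.sets_into_space by blast
  obtain A where A: "A \<in> sets N"
    and A1: "\<And>X. X \<in> sets N \<Longrightarrow> X \<subseteq> A \<Longrightarrow> emeasure M X \<le> emeasure M' X"
    and A2: "\<And>X. X \<in> sets N \<Longrightarrow> X \<inter> A = {} \<Longrightarrow> emeasure M' X \<le> emeasure M X"
    using finite_unsigned_Hahn_decomposition[of M' M] M.finite_measure_axioms M'.finite_measure_axioms
    by auto
  \<comment> \<open>Replacing \<open>B\<close> by \<open>A\<close> adds \<open>A - B\<close>, where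
    \<open>M'\<close> dominates, and removes \<open>B - A\<close>, where \<open>M\<close> dominates;
    neither change lowers \<open>s\<close>.\<close>
  have max: "s B \<le> s A" if B: "B \<in> sets N" for B
  proof -
    have "measure M (A - B) \<le> measure M' (A - B)"
      using A1[of "A - B"] A B by (simp add: M.emeasure_eq_measure M'.emeasure_eq_measure)
    moreover have "measure M' (B - A) \<le> measure M (B - A)"
      using A2[of "B - A"] A B by (auto simp: M.emeasure_eq_measure M'.emeasure_eq_measure)
    ultimately show ?thesis
      using A B M.finite_measure_Diff'[of A B] M'.finite_measure_Diff'[of A B]
        M.finite_measure_Diff'[of B A] M'.finite_measure_Diff'[of B A]
      by (simp add: s_def Int_commute)
  qed
  \<comment> \<open>\<open>s\<close> is modular and neither the union nor the intersection can
    exceed \<open>s A\<close>, so both attain it.\<close>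
  have s_Un: "s (B \<union> B') = s A" if B: "B \<in> sets N" "B' \<in> sets N" and m: "s B = s A" "s B' = s A" for B B'
  proof -
    have "measure K (B \<union> B') + measure K (B \<inter> B') = measure K B + measure K B'"
      if "prob_space K" "sets K = sets N" for K
    proof -
      interpret prob_space K by fact
      show ?thesis using that B by (subst finite_measure_Union') (auto simp: finite_measure_Diff' Int_commute)
    qed
    from this[OF p(1)] this[OF p(2)] have "s (B \<union> B') + s (B \<inter> B') = s B + s B'"
      by (simp add: s_def)
    with m max[of "B \<union> B'"] max[of "B \<inter> B'"] B show ?thesis by simp
  qed
  define P where "P n = (pre ^^ n) A" for n
  have P: "P n \<in> sets N" "s (P n) = s A" for n
    by (induction n) (simp_all add: P_def A pre_sets s_pre)
  define U where "U = (\<Union>n. P n)"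
  have U: "U \<in> sets N" using P by (auto simp: U_def)
  have fin: "s (\<Union>k\<le>n. P k) = s A" for n
  proof (induction n)
    case (Suc n)
    have "(\<Union>k\<le>Suc n. P k) = (\<Union>k\<le>n. P k) \<union> P (Suc n)" by (auto simp: atMost_Suc)
    moreover have "(\<Union>k\<le>n. P k) \<in> sets N" using P by auto
    ultimately show ?case using s_Un Suc P by simp
  qed (simp add: P)
  \<comment> \<open>Finite unions of the \<open>P n\<close> are maximisers; continuity from below
    along the increasing partial unions carries this over to \<open>U\<close>.\<close>
  have sU: "s U = s A"
  proof -
    have inc: "incseq (\<lambda>n. \<Union>k\<le>n. P k)" by (intro monoI UN_mono) auto
    have "(\<Union>n. \<Union>k\<le>n. P k) = U" by (auto simp: U_def)
    moreover have "(\<lambda>n. s (\<Union>k\<le>n. P k)) \<longlonglongrightarrow> s (\<Union>n. \<Union>k\<le>n. P k)"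
      unfolding s_def using P inc
      by (intro tendsto_diff M.finite_Lim_measure_incseq M'.finite_Lim_measure_incseq) auto
    ultimately show ?thesis using fin LIMSEQ_unique[OF _ tendsto_const] by fastforce
  qed
  \<comment> \<open>Taking preimages only shifts the index of the \<open>P n\<close>.\<close>
  have "pre U \<subseteq> U"
  proof
    fix x assume "x \<in> pre U"
    then obtain n where "x \<in> pre (P n)" by (auto simp: U_def pre_def)
    then have "x \<in> P (Suc n)" by (simp add: P_def)
    then show "x \<in> U" by (auto simp: U_def)
  qed
  define Q where "Q n = (pre ^^ n) U" for n
  have Q: "Q n \<in> sets N" "s (Q n) = s A" for n
    by (induction n) (simp_all add: Q_def U sU pre_sets s_pre)
  have QS: "Q (Suc n) = pre (Q n)" for n by (simp add: Q_def)
  have Qdec: "Q (Suc n) \<subseteq> Q n" for n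
  proof (induction n)
    case 0 then show ?case using \<open>pre U \<subseteq> U\<close> by (simp add: Q_def)
  next
    case (Suc n) then show ?case unfolding QS[of "Suc n"] QS[of n] by (auto simp: pre_def)
  qed
  then have dec: "decseq Q" by (simp add: decseq_Suc_iff)
  define C where "C = (\<Inter>n. Q n)"
  have C: "C \<in> sets N" using Q by (auto simp: C_def)
  have "(\<lambda>n. s (Q n)) \<longlonglongrightarrow> s C"
    unfolding s_def C_def using Q dec
    by (intro tendsto_diff M.finite_Lim_measure_decseq M'.finite_Lim_measure_decseq) auto
  then have sC: "s C = s A" using Q LIMSEQ_unique[OF _ tendsto_const] by fastforce
  \<comment> \<open>The preimage again shifts the index, and a decreasing sequence keeps its
    intersection when its first set is dropped; so \<open>C\<close> is exactly invariant.\<close>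
  have "pre C = (\<Inter>n. Q (Suc n))"
    by (auto simp: C_def QS pre_def)
  also have "\<dots> = C" unfolding C_def
  proof (intro antisym subsetI INT_I)
    fix x n assume "x \<in> (\<Inter>n. Q (Suc n))"
    then show "x \<in> Q n" using Qdec by blast
  qed auto
  finally have "pre C = C" .
  show ?thesis
    using that[of C] C \<open>pre C = C\<close> max sC by (simp add: s_def pre_def)
qed

text \<open>An invariant maximiser \<open>C\<close> of \<open>M' - M\<close> has measure 0 or 1
  under both measures. If the maximum were not positive, \<open>M'\<close> would lie below
  \<open>M\<close> on every set and on its complement, which forces two probability measures to
  agree. A positive difference leaves only 0 for \<open>M\<close> and 1 for
  \<open>M'\<close>.\<close>

lemma ergodic_measures_mutually_singular:
  assumes M: "M \<in> ergodic_measures N T" and M': "M' \<in> ergodic_measures N T" and "M \<noteq> M'"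
  obtains C where "C \<in> sets N" "emeasure M C = 0" "emeasure M' C = 1"
proof -
  have inv: "M \<in> invariant_measures N T" "M' \<in> invariant_measures N T"
    using M M' by (auto simp: ergodic_measures_def)
  then have sM [simp]: "sets M = sets N" "sets M' = sets N" and p: "prob_space M" "prob_space M'"
    by (auto simp: invariant_measures_def)
  interpret M: prob_space M by fact
  interpret M': prob_space M' by fact
  obtain C where C: "C \<in> sets N" "T -` C \<inter> space N = C"
    and max: "\<And>B. B \<in> sets N \<Longrightarrow> measure M' B - measure M B \<le> measure M' C - measure M C"
    using exists_invariant_maximal_difference[OF inv] by metis
  have "emeasure M C = 0 \<or> emeasure M C = 1" "emeasure M' C = 0 \<or> emeasure M' C = 1"
    using M M' C by (auto simp: ergodic_measures_def)
  moreover have False if le: "measure M' C \<le> measure M C"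
  proof -
    have 1: "measure M' B \<le> measure M B" if "B \<in> sets N" for B
      using max[OF that] le by simp
    have "M = M'"
    proof (rule measure_eqI)
      fix B assume "B \<in> sets M"
      then have B: "B \<in> sets N" "space N - B \<in> sets N" by auto
      have "space M = space N" "space M' = space N"
        by (rule sets_eq_imp_space_eq; simp)+
      then have "measure M' B = measure M B"
        using 1[OF B(1)] 1[OF B(2)] M.prob_compl[of B] M'.prob_compl[of B] B by simp
      then show "emeasure M B = emeasure M' B"
        by (simp add: M.emeasure_eq_measure M'.emeasure_eq_measure)
    qed simp
    with \<open>M \<noteq> M'\<close> show False by simp
  qed
  ultimately have "emeasure M C = 0 \<and> emeasure M' C = 1"
    by (force simp: M.emeasure_eq_measure M'.emeasure_eq_measure)
  then show ?thesis using that C by blast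
qed

section \<open>Borel measurability of the fibre cardinality\<close>

lemma compact_finite_small_cover:
  fixes K :: "'c::metric_space set"
  assumes "compact K" "0 < e"
  obtains D where "finite D" "K \<subseteq> (\<Union>c\<in>D. cball c e)"
proof -
  obtain D where "D \<subseteq> K" "finite D" "K \<subseteq> (\<Union>c\<in>D. ball c e)"
    using compactE_image[OF assms(1), of K "\<lambda>c. ball c e"] assms(2)
    by (metis (no_types, lifting) UN_I centre_in_ball open_ball subsetI)
  moreover have "(\<Union>c\<in>D. ball c e) \<subseteq> (\<Union>c\<in>D. cball c e)"
    by (intro UN_mono ball_subset_cball order_refl)
  ultimately show ?thesis using that[of D] by blast
qed

lemma enat_le_ecard_iff: "enat k \<le> ecard A \<longleftrightarrow> (\<exists>P\<subseteq>A. finite P \<and> card P = k)"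
proof (cases "finite A")
  case True
  then show ?thesis
    by (metis card_mono ecard_def enat_ord_simps(1) obtain_subset_with_card_n rev_finite_subset)
next
  case False
  then show ?thesis
    using infinite_arbitrarily_large[OF False, of k] by (auto simp: ecard_def)
qed

lemma finite_set_min_dist:
  fixes P :: "'c::metric_space set"
  assumes "finite P"
  obtains e where "0 < e" "\<And>x y. x \<in> P \<Longrightarrow> y \<in> P \<Longrightarrow> x \<noteq> y \<Longrightarrow> e \<le> dist x y"
proof -
  have "\<exists>e>0. \<forall>y\<in>P. x \<noteq> y \<longrightarrow> e \<le> dist x y" for x
    using finite_set_avoid[OF assms] by metis
  then obtain e where e: "\<And>x. e x > 0" "\<And>x y. y \<in> P \<Longrightarrow> x \<noteq> y \<Longrightarrow> e x \<le> dist x y"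
    by metis
  show ?thesis
  \<comment> \<open>Inserting \<open>1\<close> keeps the set nonempty, so that the minimum makes
    sense for empty \<open>P\<close> too.\<close>
  proof (rule that[of "Min (insert 1 (e ` P))"])
    show "0 < Min (insert 1 (e ` P))" using assms e by (subst Min_gr_iff) auto
    fix x y assume "x \<in> P" "y \<in> P" "x \<noteq> y"
    then show "Min (insert 1 (e ` P)) \<le> dist x y"
      using assms e(2)[of y x] by (meson Min_le finite_imageI finite_insert image_eqI insertCI order_trans)
  qed
qed

text \<open>A fibre has at least \<open>k\<close> points iff \<open>k\<close> disjoint members of a fixed countable family of
  small compact sets meet it, and images of compact sets are closed.\<close>

lemma fibre_ecard_level_borel:
  fixes q :: "'c::metric_space \<Rightarrow> 'b::t2_space" and K :: "nat \<Rightarrow> 'c set"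
  assumes K: "\<And>n. compact (K n)" and q: "continuous_on UNIV q"
  shows "{y. enat k \<le> ecard ((\<Union>n. K n) \<inter> q -` {y})} \<in> sets borel"
proof -
  have "\<exists>D. finite D \<and> K n \<subseteq> (\<Union>c\<in>D. cball c (inverse (real (Suc m))))" for n m
    using compact_finite_small_cover[OF K, of "inverse (real (Suc m))" n] by (metis inverse_positive_iff_positive of_nat_0_less_iff zero_less_Suc)
  then obtain D where D: "\<And>n m. finite (D n m)"
    "\<And>n m. K n \<subseteq> (\<Union>c\<in>D n m. cball c (inverse (real (Suc m))))" by metis
  \<comment> \<open>Cutting closed balls with \<open>K n\<close> makes the members compact. Finite
    covers for the radii \<open>1 / (m + 1)\<close> keep the family countable and still give
    arbitrarily small members around each point.\<close>
  define F where "F = (\<Union>n m. (\<lambda>c. cball c (inverse (real (Suc m))) \<inter> K n) ` D n m)"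
  have "countable F"
    unfolding F_def using D(1) by (intro countable_UN countableI_type countable_image uncountable_infinite countable_finite)
  have cF: "compact C" "C \<subseteq> (\<Union>n. K n)" if "C \<in> F" for C
    using that K by (auto simp: F_def intro!: closed_Int_compact)
  have small: "\<exists>C\<in>F. x \<in> C \<and> C \<subseteq> cball x e" if x: "x \<in> (\<Union>n. K n)" and "e > 0" for x e
  proof -
    obtain m where m: "inverse (real (Suc m)) < e / 2"
      using reals_Archimedean[of "e / 2"] \<open>e > 0\<close> by auto
    from x obtain n where n: "x \<in> K n" by auto
    then obtain c where c: "c \<in> D n m" "x \<in> cball c (inverse (real (Suc m)))"
      using D(2) by blast
    have "cball c (inverse (real (Suc m))) \<inter> K n \<subseteq> cball x e"
    proof
      fix z assume "z \<in> cball c (inverse (real (Suc m))) \<inter> K n"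
      then have "dist x z \<le> dist c x + dist c z" "dist c z \<le> inverse (real (Suc m))"
        by (auto simp: dist_triangle3)
      then show "z \<in> cball x e" using c m by simp
    qed
    then show ?thesis using c n unfolding F_def by blast
  qed
  define \<A> where "\<A> = {E. finite E \<and> E \<subseteq> F \<and> card E = k \<and> disjoint E}"
  have "countable \<A>"
    by (rule countable_subset[OF _ countable_Collect_finite_subset[OF \<open>countable F\<close>]]) (auto simp: \<A>_def)
  have "{y. enat k \<le> ecard ((\<Union>n. K n) \<inter> q -` {y})} = (\<Union>E\<in>\<A>. \<Inter>C\<in>E. q ` C)"
  proof (intro antisym subsetI)
    fix y assume "y \<in> {y. enat k \<le> ecard ((\<Union>n. K n) \<inter> q -` {y})}"
    then obtain P where P: "P \<subseteq> (\<Union>n. K n) \<inter> q -` {y}" "finite P" "card P = k"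
      by (auto simp: enat_le_ecard_iff)
    obtain e where e: "0 < e" "\<And>x y. x \<in> P \<Longrightarrow> y \<in> P \<Longrightarrow> x \<noteq> y \<Longrightarrow> e \<le> dist x y"
      using finite_set_min_dist[OF P(2)] by metis
    \<comment> \<open>Distinct points of \<open>P\<close> are at least \<open>e\<close> apart, so
      sets within distance \<open>e / 3\<close> of two of them are disjoint.\<close>
    have "\<exists>C\<in>F. x \<in> C \<and> C \<subseteq> cball x (e / 3)" if "x \<in> P" for x
      using small[of x "e / 3"] that P(1) e(1) by force
    then obtain C where C: "\<And>x. x \<in> P \<Longrightarrow> C x \<in> F" "\<And>x. x \<in> P \<Longrightarrow> x \<in> C x"
      "\<And>x. x \<in> P \<Longrightarrow> C x \<subseteq> cball x (e / 3)" by metis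
    have dis: "C x \<inter> C x' = {}" if "x \<in> P" "x' \<in> P" "x \<noteq> x'" for x x'
    proof -
      have False if "z \<in> C x" "z \<in> C x'" for z
      proof -
        have "dist x z \<le> e / 3" "dist x' z \<le> e / 3"
          using C(3)[OF \<open>x \<in> P\<close>] C(3)[OF \<open>x' \<in> P\<close>] that by (metis mem_cball subsetD)+
        then show False
          using e(2)[of x x'] e(1) dist_triangle2[of x x' z] \<open>x \<in> P\<close> \<open>x' \<in> P\<close> \<open>x \<noteq> x'\<close> by simp
      qed
      then show ?thesis by blast
    qed
    have "inj_on C P" using dis C(2) by (intro inj_onI) blast
    then have "C ` P \<in> \<A>"
      using P C(1) dis by (auto simp: \<A>_def card_image disjoint_def)
    moreover have "y \<in> (\<Inter>D\<in>C ` P. q ` D)" using C(2) P(1) by auto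
    ultimately show "y \<in> (\<Union>E\<in>\<A>. \<Inter>C\<in>E. q ` C)" by blast
  next
    fix y assume "y \<in> (\<Union>E\<in>\<A>. \<Inter>C\<in>E. q ` C)"
    then obtain E where E: "finite E" "E \<subseteq> F" "card E = k" "disjoint E" "\<And>C. C \<in> E \<Longrightarrow> y \<in> q ` C"
      by (auto simp: \<A>_def)
    then have "\<forall>C\<in>E. \<exists>x. x \<in> C \<and> q x = y" by auto
    then obtain x where x: "\<And>C. C \<in> E \<Longrightarrow> x C \<in> C \<and> q (x C) = y" by metis
    \<comment> \<open>\<open>x\<close> picks a point over \<open>y\<close> in each member of
      \<open>E\<close>; as the members are disjoint, the picked points are distinct.\<close>
    have "inj_on x E"
      using E(4) x by (intro inj_onI) (metis disjointD disjoint_iff)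
    then have "card (x ` E) = k" using E by (simp add: card_image)
    moreover have "x ` E \<subseteq> (\<Union>n. K n) \<inter> q -` {y}" using x cF(2) E(2) by fastforce
    ultimately show "y \<in> {y. enat k \<le> ecard ((\<Union>n. K n) \<inter> q -` {y})}"
      unfolding mem_Collect_eq enat_le_ecard_iff
      using E(1) by (intro exI[of _ "x ` E"] conjI finite_imageI)
  qed
  moreover have "(\<Inter>C\<in>E. q ` C) \<in> sets borel" if "E \<in> \<A>" for E
  proof -
    have "closed (\<Inter>C\<in>E. q ` C)"
      using that cF(1) continuous_on_subset[OF q]
      by (intro closed_INT ballI compact_imp_closed compact_continuous_image) (auto simp: \<A>_def)
    then show ?thesis by (rule borel_closed)
  qed
  ultimately show ?thesis using \<open>countable \<A>\<close> by (metis sets.countable_UN'')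
qed

lemma measurable_fibre_ecard:
  fixes q :: "'c::metric_space \<Rightarrow> 'b::t2_space" and K :: "nat \<Rightarrow> 'c set"
  assumes "\<And>n. compact (K n)" "continuous_on UNIV q"
  shows "(\<lambda>y. ecard ((\<Union>n. K n) \<inter> q -` {y})) \<in> measurable borel (count_space UNIV)"
proof -
  let ?f = "\<lambda>y. ecard ((\<Union>n. K n) \<inter> q -` {y})"
  have lev: "{y. enat k \<le> ?f y} \<in> sets borel" for k
    using fibre_ecard_level_borel[OF assms] .
  have "?f -` {a} \<in> sets borel" for a
  proof (cases a)
    case (enat k)
    have "?f -` {a} = {y. enat k \<le> ?f y} - {y. enat (Suc k) \<le> ?f y}"
      unfolding enat by (auto simp: Suc_ile_eq)
    moreover have "\<dots> \<in> sets borel" using lev lev by (rule sets.Diff)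
    ultimately show ?thesis by presburger
  next
    case infinity
    have "?f -` {a} = (\<Inter>k. {y. enat k \<le> ?f y})"
    proof (intro antisym subsetI)
      fix y assume "y \<in> (\<Inter>k. {y. enat k \<le> ?f y})"
      then have "enat (Suc k) \<le> ?f y" for k by blast
      then have "?f y \<noteq> enat k" for k by (metis Suc_ile_eq order_less_irrefl)
      then show "y \<in> ?f -` {a}" using infinity by (cases "?f y") auto
    qed (auto simp: infinity)
    moreover have "(\<Inter>k. {y. enat k \<le> ?f y}) \<in> sets borel"
      using lev by (intro sets.countable_INT'') simp_all
    ultimately show ?thesis by presburger
  qed
  then show ?thesis by (simp add: measurable_count_space_eq2_countable)
qed

section \<open>The degree as the almost sure fibre cardinality\<close>

text \<open>\<open>T\<close> maps the fibre over \<open>y\<close> bijectively onto the fibre over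
  \<open>S y\<close>, so each level set of the cardinality is \<open>S\<close>-invariant and, by
  ergodicity, has measure 0 or 1. Countably many level sets cover the space, so one is not null and
  hence has full measure.\<close>

lemma factor_quadruple_AE_fibre:
  assumes fq: "factor_quadruple T S \<pi> \<nu>"
  shows "AE y in \<nu>. ecard (\<pi> -` {y}) = fiber_degree \<pi> \<nu>"
proof -
  have fm: "factor_map T S \<pi>" and erg: "\<nu> \<in> ergodic_measures borel S"
    using fq by (auto simp: factor_quadruple_def)
  have sets [simp]: "sets \<nu> = sets borel" and "prob_space \<nu>"
    using erg by (auto simp: ergodic_measures_def invariant_measures_def)
  interpret prob_space \<nu> by fact
  have comp: "compact (UNIV :: 'a set)" and cont: "continuous_on UNIV \<pi>" and eq: "\<pi> \<circ> T = S \<circ> \<pi>"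
    and hT: "\<exists>T'. homeomorphism UNIV UNIV T T'" and hS: "\<exists>S'. homeomorphism UNIV UNIV S S'"
    using fm by (auto simp: factor_map_def top_dyn_sys_def)
  have bT: "bij T" and bS: "bij S"
    using hT hS unfolding homeomorphism_def by (metis UNIV_I bijI inj_on_inverseI)+
  have inv: "ecard (\<pi> -` {S y}) = ecard (\<pi> -` {y})" for y
  proof -
    have "\<pi> (T x) = S (\<pi> x)" for x using eq by (metis comp_apply)
    then have "T -` \<pi> -` {S y} = \<pi> -` {y}"
      using bS by (auto simp: bij_def dest: injD)
    then have "\<pi> -` {S y} = T ` (\<pi> -` {y})"
      using bT by (metis bij_is_surj surj_image_vimage_eq)
    moreover have "inj_on T (\<pi> -` {y})" using bT by (metis bij_def inj_on_subset subset_UNIV)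
    ultimately show ?thesis by (simp add: ecard_def card_image finite_image_iff)
  qed
  have meas: "(\<lambda>y. ecard (\<pi> -` {y})) \<in> measurable \<nu> (count_space UNIV)"
    using measurable_fibre_ecard[of "\<lambda>_. UNIV" \<pi>] comp cont
    by (simp add: measurable_def sets_eq_imp_space_eq[OF sets])
  define A where "A k = {y. ecard (\<pi> -` {y}) = k}" for k
  have sp: "space \<nu> = UNIV" using sets_eq_imp_space_eq[OF sets] by simp
  have A: "A k \<in> sets \<nu>" for k
    using measurable_sets[OF meas, of "{k}"] by (simp add: A_def vimage_def sp)
  have "\<exists>k. emeasure \<nu> (A k) \<noteq> 0"
  proof (rule ccontr)
    assume "\<nexists>k. emeasure \<nu> (A k) \<noteq> 0"
    then have "A k \<in> null_sets \<nu>" for k using A by auto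
    then have "(\<Union>k. A k) \<in> null_sets \<nu>" by (intro null_sets_UN) auto
    moreover have "(\<Union>k. A k) = space \<nu>" by (auto simp: A_def sp)
    ultimately show False using emeasure_space_1 by auto
  qed
  then obtain k where "emeasure \<nu> (A k) \<noteq> 0" by blast
  moreover have "S -` A k \<inter> space borel = A k" by (auto simp: A_def inv)
  ultimately have "emeasure \<nu> (A k) = 1"
    using erg A by (auto simp: ergodic_measures_def)
  then have "AE y in \<nu>. y \<in> A k" using A by (simp add: AE_in_set_eq_1 emeasure_eq_measure)
  then have "AE y in \<nu>. ecard (\<pi> -` {y}) = k" by (simp add: A_def)
  with fiber_degree_eqI[OF \<open>prob_space \<nu>\<close> this] show ?thesis by simp
qed

section \<open>Measurable counting of fibre enumerations\<close>

text \<open>Extensional functions are fixed at \<open>undefined\<close> outside \<open>I\<close>.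
  The set is therefore a product over all indices, with singletons at the remaining ones, and
  Tychonoff's theorem applies.\<close>

lemma compact_PiE_fun:
  fixes C :: "'i \<Rightarrow> 'a::t2_space set"
  assumes "\<And>i. i \<in> I \<Longrightarrow> compact (C i)"
  shows "compact (PiE I C)"
proof -
  have "PiE I C = PiE UNIV (\<lambda>i. if i \<in> I then C i else {undefined})"
    by (auto simp: PiE_def Pi_def extensional_def split: if_splits)
  moreover have "compactin (product_topology (\<lambda>_. euclidean) UNIV)
      (PiE UNIV (\<lambda>i. if i \<in> I then C i else {undefined}))"
    using assms by (subst compactin_PiE) (auto simp: compactin_euclidean_iff)
  ultimately show ?thesis
    by (metis compactin_euclidean_iff euclidean_product_topology)
qed

text \<open>Over a fibre with exactly \<open>d\<close> points an injective \<open>d\<close>-tuple is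
  onto, so these are the enumerations of the fibre lying in the rectangle with sides
  \<open>C i\<close>.\<close>

definition fibre_enumerations ::
  "nat \<Rightarrow> ('a \<Rightarrow> 'b) \<Rightarrow> (nat \<Rightarrow> 'a set) \<Rightarrow> 'b \<Rightarrow> (nat \<Rightarrow> 'a) set" where
  "fibre_enumerations d \<pi> C y =
     {x \<in> PiE {1..d} C. inj_on x {1..d} \<and> (\<forall>i\<in>{1..d}. \<pi> (x i) = y)}"

text \<open>Injectivity is not a closed condition, so the tuples are exhausted by compact sets
  \<open>K n\<close> on which distinct coordinates are at least \<open>1 / (n + 1)\<close> apart. On
  their union the enumerations are the fibres of \<open>\<lambda>x. \<pi> (x 1)\<close>, where
  \<open>d \<ge> 1\<close> makes 1 a genuine index, and \<open>measurable_fibre_ecard\<close>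
  applies.\<close>

lemma measurable_ecard_fibre_enumerations:
  fixes \<pi> :: "'a::metric_space \<Rightarrow> 'b::metric_space"
  assumes comp: "compact (UNIV :: 'a set)" and \<pi>: "continuous_on UNIV \<pi>"
    and C: "\<And>i. closed (C i)" and d: "1 \<le> d"
  shows "(\<lambda>y. ecard (fibre_enumerations d \<pi> C y)) \<in> measurable borel (count_space UNIV)"
proof -
  define K where "K n = {x. \<forall>i\<in>{1..d}. \<forall>j\<in>{1..d}. \<pi> (x i) = \<pi> (x j)} \<inter>
    {x. \<forall>i\<in>{1..d}. \<forall>j\<in>{1..d}. i \<noteq> j \<longrightarrow> inverse (real (Suc n)) \<le> dist (x i) (x j)} \<inter>
    PiE {1..d} C" for n
  have coord: "continuous_on UNIV (\<lambda>x :: nat \<Rightarrow> 'a. \<pi> (x i))" for i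
    by (rule continuous_on_compose2[OF \<pi>]) auto
  have "compact (K n)" for n
    unfolding K_def
  proof (rule closed_Int_compact)
    show "compact (PiE {1..d} C)"
      using comp C by (intro compact_PiE_fun) (metis Int_UNIV_right closed_Int_compact)
    have "closed {x :: nat \<Rightarrow> 'a. \<pi> (x i) = \<pi> (x j)}" for i j
      by (intro closed_Collect_eq coord)
    moreover have "closed {x :: nat \<Rightarrow> 'a. inverse (real (Suc n)) \<le> dist (x i) (x j)}" for i j
      by (intro closed_Collect_le continuous_intros continuous_on_product_coordinates)
    ultimately show "closed ({x :: nat \<Rightarrow> 'a. \<forall>i\<in>{1..d}. \<forall>j\<in>{1..d}. \<pi> (x i) = \<pi> (x j)} \<inter>
        {x. \<forall>i\<in>{1..d}. \<forall>j\<in>{1..d}. i \<noteq> j \<longrightarrow> inverse (real (Suc n)) \<le> dist (x i) (x j)})"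
      unfolding Ball_def by (intro closed_Int closed_Collect_all closed_Collect_imp) auto
  qed
  moreover have "(\<Union>n. K n) \<inter> (\<lambda>x. \<pi> (x 1)) -` {y} = fibre_enumerations d \<pi> C y" for y
  proof (intro antisym subsetI)
    fix x assume x: "x \<in> (\<Union>n. K n) \<inter> (\<lambda>x. \<pi> (x 1)) -` {y}"
    then obtain n where n: "x \<in> K n" and y: "\<pi> (x 1) = y" by auto
    have "inj_on x {1..d}"
    proof (rule inj_onI, rule ccontr)
      fix i j assume "i \<in> {1..d}" "j \<in> {1..d}" "x i = x j" "i \<noteq> j"
      with n have "inverse (real (Suc n)) \<le> dist (x i) (x j)" unfolding K_def by blast
      with \<open>x i = x j\<close> show False by simp
    qed
    moreover have "\<pi> (x i) = y" if "i \<in> {1..d}" for i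
    proof -
      have "1 \<in> {1..d}" using d by simp
      with that n have "\<pi> (x i) = \<pi> (x 1)" unfolding K_def by blast
      with y show ?thesis by simp
    qed
    ultimately show "x \<in> fibre_enumerations d \<pi> C y"
      using n by (simp add: K_def fibre_enumerations_def)
  next
    fix x assume x: "x \<in> fibre_enumerations d \<pi> C y"
    then have inj: "inj_on x {1..d}" by (simp add: fibre_enumerations_def)
    \<comment> \<open>The least distance between the finitely many values of \<open>x\<close>
      decides which \<open>K n\<close> contains \<open>x\<close>.\<close>
    obtain e where e: "0 < e"
      "\<And>u v. u \<in> x ` {1..d} \<Longrightarrow> v \<in> x ` {1..d} \<Longrightarrow> u \<noteq> v \<Longrightarrow> e \<le> dist u v"
      using finite_set_min_dist[of "x ` {1..d}"] by (metis finite_atLeastAtMost finite_imageI)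
    obtain n where "inverse (real (Suc n)) < e" using reals_Archimedean[OF e(1)] by auto
    then have "inverse (real (Suc n)) \<le> dist (x i) (x j)"
      if "i \<in> {1..d}" "j \<in> {1..d}" "i \<noteq> j" for i j
      using e(2)[of "x i" "x j"] that inj by (simp add: inj_on_eq_iff)
    then have "x \<in> K n"
      using x by (simp add: K_def fibre_enumerations_def)
    moreover have "\<pi> (x 1) = y" using x d by (simp add: fibre_enumerations_def)
    ultimately show "x \<in> (\<Union>n. K n) \<inter> (\<lambda>x. \<pi> (x 1)) -` {y}" by blast
  qed
  ultimately show ?thesis
    using measurable_fibre_ecard[of K "\<lambda>x. \<pi> (x 1)"] coord by simp
qed

section \<open>Coordinate permutations acting on the enumerations of a fibre\<close>

lemma coord_perm_in_PiE: "coord_perm d f x \<in> {1..d} \<rightarrow>\<^sub>E UNIV"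
  by (simp add: coord_perm_def)

lemma coord_perm_inverse:
  assumes "f permutes {1..d}" "x \<in> {1..d} \<rightarrow>\<^sub>E UNIV"
  shows "coord_perm d (inv f) (coord_perm d f x) = x"
proof (rule PiE_ext[of _ "{1..d}" "\<lambda>_. UNIV"])
  fix i assume i: "i \<in> {1..d}"
  then have "inv f i \<in> {1..d}"
    by (simp only: permutes_in_image[OF permutes_inv[OF assms(1)]])
  with i show "coord_perm d (inv f) (coord_perm d f x) i = x i"
    unfolding coord_perm_def by (simp add: permutes_inverses(1)[OF assms(1)])
qed (rule coord_perm_in_PiE assms(2))+

text \<open>Each of these tuples has the whole fibre as its range, by counting, so any other one
  arises from \<open>x\<close> by exactly one relabelling of the indices.\<close>

lemma bij_betw_coord_perm_fibre_enumerations: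
  assumes card: "ecard (\<pi> -` {y}) = enat d"
    and x: "x \<in> fibre_enumerations d \<pi> (\<lambda>_. UNIV) y"
  shows "bij_betw (\<lambda>f. coord_perm d f x) {f. f permutes {1..d}}
    (fibre_enumerations d \<pi> (\<lambda>_. UNIV) y)"
proof (rule bij_betw_imageI)
  have inj: "inj_on x {1..d}" and px: "\<And>i. i \<in> {1..d} \<Longrightarrow> \<pi> (x i) = y"
    using x by (auto simp: fibre_enumerations_def)
  have fin: "finite (\<pi> -` {y})" "card (\<pi> -` {y}) = d"
    using card by (auto simp: ecard_def split: if_splits)
  have img: "z ` {1..d} = \<pi> -` {y}" if "z \<in> fibre_enumerations d \<pi> (\<lambda>_. UNIV) y" for z
  proof (rule card_subset_eq[OF fin(1)])
    show "z ` {1..d} \<subseteq> \<pi> -` {y}" using that by (auto simp: fibre_enumerations_def)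
    show "card (z ` {1..d}) = card (\<pi> -` {y})"
      using that fin(2) by (simp add: fibre_enumerations_def card_image)
  qed
  show "inj_on (\<lambda>f. coord_perm d f x) {f. f permutes {1..d}}"
  proof (rule inj_onI)
    fix f g assume f: "f \<in> {f. f permutes {1..d}}" and g: "g \<in> {f. f permutes {1..d}}"
      and eq: "coord_perm d f x = coord_perm d g x"
    show "f = g"
    proof
      fix i
      show "f i = g i"
      proof (cases "i \<in> {1..d}")
        case True
        then have "x (f i) = x (g i)" using fun_cong[OF eq, of i] by (simp add: coord_perm_def)
        moreover have "f i \<in> {1..d}" "g i \<in> {1..d}"
          using True f g by (simp_all only: mem_Collect_eq permutes_in_image)
        ultimately show ?thesis using inj by (simp add: inj_on_eq_iff)
      next
        case False
        then show ?thesis using f g by (simp add: permutes_def)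
      qed
    qed
  qed
  show "(\<lambda>f. coord_perm d f x) ` {f. f permutes {1..d}} = fibre_enumerations d \<pi> (\<lambda>_. UNIV) y"
  proof (intro antisym subsetI)
    fix z assume "z \<in> (\<lambda>f. coord_perm d f x) ` {f. f permutes {1..d}}"
    then obtain f where f: "f permutes {1..d}" and z: "z = coord_perm d f x" by blast
    have fi: "f i \<in> {1..d}" if "i \<in> {1..d}" for i using that by (simp only: permutes_in_image[OF f])
    have "z i = x (f i)" if "i \<in> {1..d}" for i using that z by (simp add: coord_perm_def)
    moreover have "f i = f j \<Longrightarrow> i = j" for i j using permutes_inj[OF f] by (simp add: inj_eq)
    ultimately show "z \<in> fibre_enumerations d \<pi> (\<lambda>_. UNIV) y"
      using z coord_perm_in_PiE[of d f x] px fi inj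
      unfolding fibre_enumerations_def mem_Collect_eq inj_on_def by metis
  next
    fix z assume z: "z \<in> fibre_enumerations d \<pi> (\<lambda>_. UNIV) y"
    \<comment> \<open>\<open>f i\<close> is the position at which \<open>x\<close> takes the value
      \<open>z i\<close>; outside \<open>{1..d}\<close> it is the identity, as
      \<open>permutes\<close> demands.\<close>
    define f where "f i = (if i \<in> {1..d} then inv_into {1..d} x (z i) else i)" for i
    have zi: "z i \<in> x ` {1..d}" if "i \<in> {1..d}" for i using img[OF x] img[OF z] that by blast
    have xf: "x (f i) = z i" and fi: "f i \<in> {1..d}" if "i \<in> {1..d}" for i
      using that zi[OF that] unfolding f_def by (simp_all only: if_True f_inv_into_f inv_into_into)
    have "inj_on f {1..d}"
      using z xf unfolding fibre_enumerations_def mem_Collect_eq inj_on_def by metis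
    moreover have "f ` {1..d} \<subseteq> {1..d}" using fi by blast
    ultimately have "bij_betw f {1..d} {1..d}"
      by (simp add: bij_betw_def endo_inj_surj)
    then have "f permutes {1..d}" by (rule bij_imp_permutes) (auto simp: f_def)
    moreover have "coord_perm d f x = z"
    proof (rule PiE_ext[of _ "{1..d}" "\<lambda>_. UNIV"])
      show "z \<in> {1..d} \<rightarrow>\<^sub>E UNIV" using z by (simp add: fibre_enumerations_def)
    qed (use coord_perm_in_PiE xf in \<open>auto simp: coord_perm_def\<close>)
    ultimately show "z \<in> (\<lambda>f. coord_perm d f x) ` {f. f permutes {1..d}}" by blast
  qed
qed

text \<open>The sum counts the permutations that move \<open>x\<close> into the rectangle. By the
  bijection this is the number of enumerations in it, which depends on \<open>x\<close> only through
  its base point \<open>y\<close>.\<close>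

lemma sum_indicator_coord_perm:
  assumes card: "ecard (\<pi> -` {y}) = enat d"
    and x: "x \<in> fibre_enumerations d \<pi> (\<lambda>_. UNIV) y"
  shows "(\<Sum>f | f permutes {1..d}. indicator (PiE {1..d} C) (coord_perm d f x)) =
    ennreal_of_enat (ecard (fibre_enumerations d \<pi> C y))"
proof -
  let ?P = "{f. f permutes {1..d}}" and ?g = "\<lambda>f. coord_perm d f x"
  let ?Q = "{f \<in> ?P. ?g f \<in> PiE {1..d} C}"
  note bij = bij_betw_coord_perm_fibre_enumerations[OF card x]
  have fin: "finite ?P" by (simp add: finite_permutations)
  have sub: "fibre_enumerations d \<pi> C y = fibre_enumerations d \<pi> (\<lambda>_. UNIV) y \<inter> PiE {1..d} C"
    by (auto simp: fibre_enumerations_def)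
  have "fibre_enumerations d \<pi> C y = ?g ` ?Q"
    unfolding sub bij_betw_imp_surj_on[OF bij, symmetric] by blast
  moreover have "inj_on ?g ?Q"
    using bij_betw_imp_inj_on[OF bij] by (rule inj_on_subset) blast
  ultimately have "ecard (fibre_enumerations d \<pi> C y) = enat (card ?Q)"
    using fin by (simp add: ecard_def card_image)
  moreover have "(\<Sum>f\<in>?P. indicator (PiE {1..d} C) (?g f)) = (of_nat (card ?Q) :: ennreal)"
    using fin by (simp add: indicator_def sum.If_cases Int_def)
  ultimately show ?thesis by simp
qed

lemma measurable_coord_perm:
  assumes "f permutes {1..d}"
  shows "coord_perm d f \<in> measurable (PiM {1..d} (\<lambda>_. M)) (PiM {1..d} (\<lambda>_. M))"
proof -
  have "f i \<in> {1..d}" if "i \<in> {1..d}" for i using that by (simp only: permutes_in_image[OF assms])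
  then have "(\<lambda>x. \<lambda>i\<in>{1..d}. x (f i)) \<in> measurable (PiM {1..d} (\<lambda>_. M)) (PiM {1..d} (\<lambda>_. M))"
    by (intro measurable_restrict measurable_component_singleton)
  then show ?thesis by (simp add: coord_perm_def[abs_def])
qed

section \<open>The sum of all permuted images of a degree joining\<close>

text \<open>The sum becomes one integral over \<open>L\<close> whose integrand is almost surely a
  function of the base point \<open>\<pi> (x i)\<close>, and this point has law
  \<open>\<nu>\<close>.\<close>

lemma degree_joining_sum_closed_rectangle:
  fixes T :: "'a::metric_space \<Rightarrow> 'a" and \<pi> :: "'a \<Rightarrow> 'b::metric_space"
  assumes fq: "factor_quadruple T S \<pi> \<nu>" and dj: "degree_joining d T \<pi> \<nu> L"
    and C: "\<And>i. closed (C i)"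
  shows "(\<Sum>f | f permutes {1..d}.
      emeasure (distr L (power_space d) (coord_perm d f)) (PiE {1..d} C)) =
    (\<integral>\<^sup>+y. ennreal_of_enat (ecard (fibre_enumerations d \<pi> C y)) \<partial>\<nu>)"
proof -
  let ?P = "{f. f permutes {1..d}}" and ?R = "PiE {1..d} C"
  let ?h = "\<lambda>y. ennreal_of_enat (ecard (fibre_enumerations d \<pi> C y))"
  have deg: "fiber_degree \<pi> \<nu> = enat d" and sep: "AE x in L. inj_on x {1..d}"
    and fp: "emeasure L (fiber_product d \<pi>) = 1" and jo: "joining_over d \<pi> \<nu> L"
    and sL: "sets L = sets (power_space d)" and pL: "prob_space L"
    using dj by (auto simp: degree_joining_def relative_joining_def separating_def invariant_measures_def)
  have comp: "compact (UNIV :: 'a set)" and cont: "continuous_on UNIV \<pi>"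
    using fq by (auto simp: factor_quadruple_def factor_map_def top_dyn_sys_def)
  interpret prob_space L by fact
  obtain i where i: "i \<in> {1..d}" and \<nu>: "distr (distr L borel (\<lambda>x. x i)) borel \<pi> = \<nu>"
    using jo by (auto simp: joining_over_def)
  have mi: "(\<lambda>x. x i) \<in> measurable L borel"
    unfolding measurable_cong_sets[OF sL refl] using i by (rule measurable_component_singleton)
  have m\<pi>: "\<pi> \<in> measurable borel borel" using cont by (rule borel_measurable_continuous_onI)
  have m\<pi>': "\<pi> \<in> measurable (distr L borel (\<lambda>x. x i)) borel" using m\<pi> by simp
  have mh: "?h \<in> borel_measurable borel"
  proof (rule measurable_compose[OF measurable_ecard_fibre_enumerations[OF comp cont C]])
    show "1 \<le> d" using i by simp
  qed simp
  have mp: "coord_perm d f \<in> measurable L (power_space d)" if "f \<in> ?P" for f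
    unfolding measurable_cong_sets[OF sL refl] using that by (intro measurable_coord_perm) simp
  have R: "?R \<in> sets (power_space d)"
    using C by (intro sets_PiM_I_finite) (simp_all add: borel_closed)
  have "AE y in \<nu>. ecard (\<pi> -` {y}) = enat d"
    using factor_quadruple_AE_fibre[OF fq] deg by simp
  then have "AE y in distr (distr L borel (\<lambda>x. x i)) borel \<pi>. ecard (\<pi> -` {y}) = enat d"
    unfolding \<nu> .
  then have card: "AE x in L. ecard (\<pi> -` {\<pi> (x i)}) = enat d"
    by (rule AE_distrD[OF mi AE_distrD[OF m\<pi>']])
  \<comment> \<open>A set outside the sigma-algebra has \<open>emeasure\<close> 0 by convention, so
    the value 1 proves measurability.\<close>
  have "fiber_product d \<pi> \<in> sets L"
    using fp emeasure_notin_sets[of "fiber_product d \<pi>" L] by (cases "fiber_product d \<pi> \<in> sets L") simp_all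
  then have "AE x in L. x \<in> fiber_product d \<pi>"
    using fp by (simp add: AE_in_set_eq_1 emeasure_eq_measure)
  with sep card have ae: "AE x in L. (\<Sum>f\<in>?P. indicator ?R (coord_perm d f x)) = ?h (\<pi> (x i))"
  proof eventually_elim
    case (elim x)
    have "x \<in> {1..d} \<rightarrow>\<^sub>E UNIV" "\<forall>j\<in>{1..d}. \<pi> (x j) = \<pi> (x i)"
      using elim(3) i unfolding fiber_product_def by blast+
    with elim have "x \<in> fibre_enumerations d \<pi> (\<lambda>_. UNIV) (\<pi> (x i))"
      unfolding fibre_enumerations_def by blast
    with elim show ?case by (intro sum_indicator_coord_perm)
  qed
  have "(\<Sum>f\<in>?P. emeasure (distr L (power_space d) (coord_perm d f)) ?R) =
      (\<Sum>f\<in>?P. \<integral>\<^sup>+x. indicator ?R (coord_perm d f x) \<partial>L)"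
  proof (rule sum.cong[OF refl])
    fix f assume "f \<in> ?P"
    then have "(\<integral>\<^sup>+x. indicator ?R (coord_perm d f x) \<partial>L) =
        (\<integral>\<^sup>+z. indicator ?R z \<partial>distr L (power_space d) (coord_perm d f))"
      using mp R by (subst nn_integral_distr) auto
    then show "emeasure (distr L (power_space d) (coord_perm d f)) ?R =
        (\<integral>\<^sup>+x. indicator ?R (coord_perm d f x) \<partial>L)"
      using R by simp
  qed
  also have "\<dots> = (\<integral>\<^sup>+x. (\<Sum>f\<in>?P. indicator ?R (coord_perm d f x)) \<partial>L)"
    using R mp by (subst nn_integral_sum) (auto intro!: measurable_compose[OF mp])
  also have "\<dots> = (\<integral>\<^sup>+x. ?h (\<pi> (x i)) \<partial>L)"
    by (rule nn_integral_cong_AE[OF ae])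
  also have "\<dots> = (\<integral>\<^sup>+a. ?h (\<pi> a) \<partial>distr L borel (\<lambda>x. x i))"
    using measurable_compose[OF m\<pi> mh] by (subst nn_integral_distr[OF mi]) auto
  also have "\<dots> = (\<integral>\<^sup>+y. ?h y \<partial>\<nu>)"
    unfolding \<nu>[symmetric] using mh by (subst nn_integral_distr[OF m\<pi>']) auto
  finally show ?thesis .
qed

text \<open>Closed sides supply the compactness behind the counting lemma, and these rectangles
  still form an intersection-stable generator of the product sigma-algebra.\<close>

definition closed_rectangles :: "nat \<Rightarrow> (nat \<Rightarrow> 'a::metric_space) set set" where
  "closed_rectangles d = {PiE {1..d} C | C. \<forall>i. closed (C i)}"

lemma sets_power_space_closed_rectangles:
  "sets (power_space d :: (nat \<Rightarrow> 'a::metric_space) measure) =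
     sigma_sets ({1..d} \<rightarrow>\<^sub>E UNIV) (closed_rectangles d)"
proof -
  let ?G = "{{f \<in> {1..d} \<rightarrow>\<^sub>E (UNIV :: 'a set). \<forall>i\<in>j. f i \<in> A i} | A j.
      j \<in> {{1..d}} \<and> A \<in> Pi j (\<lambda>_. Collect closed)}"
  have "sets (power_space d :: (nat \<Rightarrow> 'a) measure) = sets (sigma ({1..d} \<rightarrow>\<^sub>E UNIV) ?G)"
    unfolding borel_eq_closed
  proof (rule sets_PiM_sigma[where \<Omega>="\<lambda>_. UNIV"])
    show "\<exists>S\<subseteq>Collect closed. countable S \<and> UNIV = \<Union>S"
      by (intro exI[of _ "{UNIV}"]) simp
  qed simp_all
  also have "\<dots> = sigma_sets ({1..d} \<rightarrow>\<^sub>E UNIV) ?G"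
    by (rule sets_measure_of) auto
  also have "?G = closed_rectangles d"
  proof (intro antisym subsetI)
    fix X assume "X \<in> ?G"
    then obtain A where A: "\<And>i. i \<in> {1..d} \<Longrightarrow> closed (A i)"
      and X: "X = {f \<in> {1..d} \<rightarrow>\<^sub>E UNIV. \<forall>i\<in>{1..d}. f i \<in> A i}" by blast
    \<comment> \<open>\<open>closed_rectangles\<close> asks for a closed side at every index; the
      filler \<open>{}\<close> outside \<open>{1..d}\<close> provides it without affecting
      \<open>PiE\<close>.\<close>
    have "X = PiE {1..d} (\<lambda>i. if i \<in> {1..d} then A i else {})"
      unfolding X by (auto simp: PiE_def Pi_def)
    moreover have "\<forall>i. closed (if i \<in> {1..d} then A i else {})" using A by simp
    ultimately show "X \<in> closed_rectangles d" unfolding closed_rectangles_def by blast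
  next
    fix X :: "(nat \<Rightarrow> 'a) set" assume "X \<in> closed_rectangles d"
    then obtain A where A: "\<And>i. closed (A i)" and X: "X = PiE {1..d} A"
      by (auto simp: closed_rectangles_def)
    have "X = {f \<in> {1..d} \<rightarrow>\<^sub>E UNIV. \<forall>i\<in>{1..d}. f i \<in> A i}"
      unfolding X by (auto simp: PiE_def Pi_def)
    with A show "X \<in> ?G" by blast
  qed
  finally show ?thesis .
qed

lemma Int_stable_closed_rectangles: "Int_stable (closed_rectangles d)"
proof (rule Int_stableI)
  fix X Y :: "(nat \<Rightarrow> 'a) set" assume "X \<in> closed_rectangles d" "Y \<in> closed_rectangles d"
  then obtain A B where "\<forall>i. closed (A i)" "X = PiE {1..d} A" "\<forall>i. closed (B i)" "Y = PiE {1..d} B"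
    by (auto simp: closed_rectangles_def)
  then have "X \<inter> Y = PiE {1..d} (\<lambda>i. A i \<inter> B i)" "\<forall>i. closed (A i \<inter> B i)"
    by (auto simp: PiE_Int)
  then show "X \<inter> Y \<in> closed_rectangles d" unfolding closed_rectangles_def by blast
qed

text \<open>Dynkin's argument for finite sums of measures: complements work because both sides have
  the same total mass, disjoint unions because a finite sum of convergent series can be summed
  termwise.\<close>

lemma sum_measure_eq_generator:
  assumes fin: "finite I" and G: "Int_stable G" "G \<subseteq> Pow \<Omega>"
    and p: "\<And>i. i \<in> I \<Longrightarrow> prob_space (M i)" "\<And>i. i \<in> I \<Longrightarrow> prob_space (M' i)"
    and s: "\<And>i. i \<in> I \<Longrightarrow> sets (M i) = sigma_sets \<Omega> G" "\<And>i. i \<in> I \<Longrightarrow> sets (M' i) = sigma_sets \<Omega> G"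
    and eq: "\<And>A. A \<in> G \<Longrightarrow> (\<Sum>i\<in>I. measure (M i) A) = (\<Sum>i\<in>I. measure (M' i) A)"
    and A: "A \<in> sigma_sets \<Omega> G"
  shows "(\<Sum>i\<in>I. measure (M i) A) = (\<Sum>i\<in>I. measure (M' i) A)"
  using G A
proof (induction rule: sigma_sets_induct_disjoint)
  case (basic A) then show ?case by (rule eq)
next
  case empty then show ?case by simp
next
  case (compl A)
  have sp: "space N = \<Omega>" if "sets N = sigma_sets \<Omega> G" for N
    using that sets_eq_imp_space_eq[of N "sigma \<Omega> G"] G(2) by simp
  have "measure (K i) (\<Omega> - A) = 1 - measure (K i) A"
    if "prob_space (K i)" "sets (K i) = sigma_sets \<Omega> G" for K :: "'a \<Rightarrow> 'b measure" and i
    using prob_space.prob_compl[OF that(1), of A] that(2) compl(1) sp[OF that(2)] by simp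
  then show ?case using p s compl(2) by (simp add: sum_subtractf)
next
  case (union A)
  have "(\<lambda>n. \<Sum>i\<in>I. measure (K i) (A n)) sums (\<Sum>i\<in>I. measure (K i) (\<Union>n. A n))"
    if "\<And>i. i \<in> I \<Longrightarrow> prob_space (K i)" "\<And>i. i \<in> I \<Longrightarrow> sets (K i) = sigma_sets \<Omega> G"
    for K :: "'a \<Rightarrow> 'b measure"
    using that union(1,2)
    by (intro sums_sum finite_measure.finite_measure_UNION prob_space.finite_measure) auto
  from this[of M] this[of M'] show ?case
    using p s union(3) sums_unique2 by auto
qed

text \<open>On closed rectangles both sums equal the same integral over \<open>\<nu>\<close>, and
  closed rectangles determine such sums.\<close>

lemma degree_joining_sum_coord_perm_eq:
  fixes T :: "'a::metric_space \<Rightarrow> 'a" and \<pi> :: "'a \<Rightarrow> 'b::metric_space"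
  assumes fq: "factor_quadruple T S \<pi> \<nu>"
    and dj: "degree_joining d T \<pi> \<nu> L" "degree_joining d T \<pi> \<nu> L'"
    and A: "A \<in> sets (power_space d)"
  shows "(\<Sum>f | f permutes {1..d}. measure (distr L (power_space d) (coord_perm d f)) A) =
    (\<Sum>f | f permutes {1..d}. measure (distr L' (power_space d) (coord_perm d f)) A)"
proof (rule sum_measure_eq_generator[where G="closed_rectangles d" and \<Omega>="{1..d} \<rightarrow>\<^sub>E UNIV"])
  let ?P = "{f. f permutes {1..d}}"
  have prob: "prob_space (distr K (power_space d) (coord_perm d f))"
    if "degree_joining d T \<pi> \<nu> K" "f \<in> ?P" for K f
  proof -
    have K: "sets K = sets (power_space d)" "prob_space K"
      using that(1) by (auto simp: degree_joining_def relative_joining_def invariant_measures_def)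
    have "coord_perm d f \<in> measurable K (power_space d)"
      unfolding measurable_cong_sets[OF K(1) refl] using that(2) by (intro measurable_coord_perm) simp
    with K(2) show ?thesis by (rule prob_space.prob_space_distr)
  qed
  show "prob_space (distr L (power_space d) (coord_perm d f))"
    "prob_space (distr L' (power_space d) (coord_perm d f))" if "f \<in> ?P" for f
    using prob dj that by blast+
  show "finite ?P" by (simp add: finite_permutations)
  show "Int_stable (closed_rectangles d :: (nat \<Rightarrow> 'a) set set)"
    by (rule Int_stable_closed_rectangles)
  show "closed_rectangles d \<subseteq> Pow ({1..d} \<rightarrow>\<^sub>E (UNIV :: 'a set))"
    by (auto simp: closed_rectangles_def PiE_def)
  show "A \<in> sigma_sets ({1..d} \<rightarrow>\<^sub>E UNIV) (closed_rectangles d)"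
    using A unfolding sets_power_space_closed_rectangles .
  fix R :: "(nat \<Rightarrow> 'a) set" assume "R \<in> closed_rectangles d"
  then obtain C where C: "\<And>i. closed (C i)" and R: "R = PiE {1..d} C"
    by (auto simp: closed_rectangles_def)
  \<comment> \<open>The generator argument subtracts and so needs real sums, while the integral
    lives in \<open>ennreal\<close>; injectivity of \<open>ennreal\<close> on nonnegative reals
    links the two.\<close>
  have "ennreal (\<Sum>f\<in>?P. measure (distr K (power_space d) (coord_perm d f)) R) =
      (\<integral>\<^sup>+y. ennreal_of_enat (ecard (fibre_enumerations d \<pi> C y)) \<partial>\<nu>)"
    if K: "degree_joining d T \<pi> \<nu> K" for K
  proof -
    have "ennreal (\<Sum>f\<in>?P. measure (distr K (power_space d) (coord_perm d f)) R) =
        (\<Sum>f\<in>?P. emeasure (distr K (power_space d) (coord_perm d f)) R)"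
      using finite_measure.emeasure_eq_measure[OF prob_space.finite_measure[OF prob[OF K]]]
      by (subst sum_ennreal[symmetric]) (auto intro: sum.cong[OF refl] sym)
    then show ?thesis unfolding R degree_joining_sum_closed_rectangle[OF fq K C] .
  qed
  from trans[OF this[OF dj(1)] this[OF dj(2), symmetric]]
  show "(\<Sum>f\<in>?P. measure (distr L (power_space d) (coord_perm d f)) R) =
    (\<Sum>f\<in>?P. measure (distr L' (power_space d) (coord_perm d f)) R)"
    by (subst (asm) ennreal_inj) (auto intro: sum_nonneg)
qed (simp_all only: sets_distr sets_power_space_closed_rectangles)

section \<open>Ergodicity of the permuted images and the conclusion\<close>

text \<open>The same \<open>T\<close> acts in every coordinate, so permuting coordinates commutes
  with the product map. Invariance is thus passed on, and preimages of invariant sets are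
  invariant.\<close>

lemma ergodic_measures_distr_coord_perm:
  assumes L: "L \<in> ergodic_measures (power_space d) (power_map d T)" and f: "f permutes {1..d}"
  shows "distr L (power_space d) (coord_perm d f) \<in> ergodic_measures (power_space d) (power_map d T)"
proof -
  let ?N = "power_space d" and ?p = "coord_perm d f" and ?T = "power_map d T"
  have sL: "sets L = sets ?N" and pL: "prob_space L" and T: "?T \<in> measurable ?N ?N"
    and inv: "distr L ?N ?T = L"
    and erg: "\<And>A. A \<in> sets ?N \<Longrightarrow> ?T -` A \<inter> space ?N = A \<Longrightarrow> emeasure L A = 0 \<or> emeasure L A = 1"
    using L by (auto simp: ergodic_measures_def invariant_measures_def)
  have p: "?p \<in> measurable ?N ?N" using f by (rule measurable_coord_perm)
  have pL': "?p \<in> measurable L ?N" and TL: "?T \<in> measurable L ?N"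
    unfolding measurable_cong_sets[OF sL refl] by fact+
  have fi: "f i \<in> {1..d}" if "i \<in> {1..d}" for i using that by (simp only: permutes_in_image[OF f])
  have comm: "?T (?p x) = ?p (?T x)" for x
  proof
    fix i show "?T (?p x) i = ?p (?T x) i"
      using fi[of i] by (cases "i \<in> {1..d}") (simp_all only: power_map_def coord_perm_def restrict_def if_True if_False)
  qed
  have "distr (distr L ?N ?p) ?N ?T = distr L ?N (?T \<circ> ?p)"
    using T pL' by (rule distr_distr)
  also have "?T \<circ> ?p = ?p \<circ> ?T" using comm by (simp add: fun_eq_iff)
  also have "distr L ?N (?p \<circ> ?T) = distr (distr L ?N ?T) ?N ?p"
    using p TL by (rule distr_distr[symmetric])
  finally have "distr (distr L ?N ?p) ?N ?T = distr L ?N ?p" unfolding inv .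
  moreover have "emeasure (distr L ?N ?p) A = 0 \<or> emeasure (distr L ?N ?p) A = 1"
    if A: "A \<in> sets ?N" "?T -` A \<inter> space ?N = A" for A
  proof -
    let ?B = "?p -` A \<inter> space ?N"
    have "?B \<in> sets ?N" using p A(1) by (rule measurable_sets)
    moreover have "?T -` ?B \<inter> space ?N = ?B"
    proof (intro set_eqI)
      fix x
      have "x \<in> space ?N \<Longrightarrow> ?T x \<in> space ?N" "x \<in> space ?N \<Longrightarrow> ?p x \<in> space ?N"
        using T p by (auto dest: measurable_space)
      moreover have "?T (?p x) \<in> A \<longleftrightarrow> ?p x \<in> A" if "?p x \<in> space ?N" using A(2) that by blast
      ultimately show "x \<in> ?T -` ?B \<inter> space ?N \<longleftrightarrow> x \<in> ?B" using comm[of x] by auto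
    qed
    ultimately have "emeasure L ?B = 0 \<or> emeasure L ?B = 1" by (rule erg)
    then show ?thesis
      using emeasure_distr[OF pL' A(1)] sets_eq_imp_space_eq[OF sL] by simp
  qed
  ultimately show ?thesis
    using prob_space.prob_space_distr[OF pL pL'] T
    by (simp add: ergodic_measures_def invariant_measures_def)
qed

theorem theorem4p7:
  fixes T :: "'a::metric_space \<Rightarrow> 'a" and S :: "'b::metric_space \<Rightarrow> 'b"
    and \<pi> :: "'a \<Rightarrow> 'b" and \<nu> :: "'b measure"
    and d :: nat and L L' :: "(nat \<Rightarrow> 'a) measure"
  assumes "factor_quadruple T S \<pi> \<nu>"
    and "fiber_degree \<pi> \<nu> = enat d"
    and "degree_joining d T \<pi> \<nu> L"
    and "degree_joining d T \<pi> \<nu> L'"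
  shows "\<exists>f. f permutes {1..d} \<and>
           L' = distr L (power_space d) (coord_perm d f) \<and>
           L = distr L' (power_space d) (coord_perm d (inv f))"
proof -
  let ?N = "power_space d" and ?P = "{f. f permutes {1..d}}"
  let ?L = "\<lambda>K f. distr K ?N (coord_perm d f)"
  have erg: "L \<in> ergodic_measures ?N (power_map d T)" "L' \<in> ergodic_measures ?N (power_map d T)"
    using assms(3,4) by (auto simp: degree_joining_def)
  then have sL: "sets L = sets ?N" "sets L' = sets ?N" and pL: "prob_space L'"
    by (auto simp: ergodic_measures_def invariant_measures_def)
  interpret L': prob_space L' by fact
  have finP: "finite ?P" by (simp add: finite_permutations)
  have "\<exists>f\<in>?P. ?L L f = L'"
  proof (rule ccontr)
    assume "\<not> (\<exists>f\<in>?P. ?L L f = L')"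
    then have ne: "?L L f \<noteq> L'" if "f \<in> ?P" for f using that by blast
    have "\<exists>B. B \<in> sets ?N \<and> emeasure (?L L f) B = 0 \<and> emeasure L' B = 1" if "f \<in> ?P" for f
      using ergodic_measures_mutually_singular[OF ergodic_measures_distr_coord_perm[OF erg(1)] erg(2) ne[OF that]] that
      by blast
    then obtain B where B: "\<And>f. f \<in> ?P \<Longrightarrow> B f \<in> sets ?N"
      "\<And>f. f \<in> ?P \<Longrightarrow> emeasure (?L L f) (B f) = 0" "\<And>f. f \<in> ?P \<Longrightarrow> emeasure L' (B f) = 1"
      by metis
    \<comment> \<open>\<open>A\<close> is null for every permuted image of \<open>L\<close>, yet a
      finite intersection of sets of full \<open>L'\<close>-measure.\<close>
    define A where "A = (\<Inter>f\<in>?P. B f)"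
    have id: "id \<in> ?P" by (simp add: permutes_id)
    have A: "A \<in> sets ?N"
      unfolding A_def using finP id B(1) by (intro sets.finite_INT) blast+
    have "measure (?L L f) A = 0" if "f \<in> ?P" for f
    proof -
      have "emeasure (?L L f) A \<le> emeasure (?L L f) (B f)"
        using that B(1) by (intro emeasure_mono) (auto simp: A_def)
      then show ?thesis using B(2)[OF that] by (simp add: measure_def)
    qed
    then have "(\<Sum>f\<in>?P. measure (?L L f) A) = 0" by simp
    then have "(\<Sum>f\<in>?P. measure (?L L' f) A) = 0"
      using degree_joining_sum_coord_perm_eq[OF assms(1,3,4) A] by simp
    \<comment> \<open>A vanishing sum of nonnegative terms has only zero terms; the identity
      permutation contributes \<open>L'\<close> itself.\<close>
    then have "measure (?L L' id) A = 0"
      using id finP by (simp add: sum_nonneg_eq_0_iff)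
    moreover have "?L L' id = L'"
    proof -
      \<comment> \<open>\<open>coord_perm d id\<close> restricts to \<open>{1..d}\<close>, so it
        fixes exactly the extensional tuples, which make up the whole space.\<close>
      have "?L L' id = distr L' ?N (\<lambda>x. x)"
        by (intro distr_cong) (auto simp: sets_eq_imp_space_eq[OF sL(2)] space_PiM coord_perm_def PiE_restrict)
      then show ?thesis using sL(2) by (simp add: distr_id2)
    qed
    moreover have "AE x in L'. x \<in> B f" if "f \<in> ?P" for f
      using B(1,3) that by (simp add: L'.AE_in_set_eq_1 sL L'.emeasure_eq_measure)
    then have "AE x in L'. x \<in> A"
      unfolding A_def INT_iff AE_finite_all[OF finP] by blast
    then have "measure L' A = 1" using A by (simp add: L'.AE_in_set_eq_1 sL)
    ultimately show False by simp
  qed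
  then obtain f where f: "f permutes {1..d}" and L': "L' = ?L L f" by blast
  have m: "coord_perm d f \<in> measurable L ?N"
    unfolding measurable_cong_sets[OF sL(1) refl] using f by (rule measurable_coord_perm)
  have "?L L' (inv f) = distr L ?N (coord_perm d (inv f) \<circ> coord_perm d f)"
    unfolding L' using m by (intro distr_distr measurable_coord_perm permutes_inv f)
  also have "\<dots> = distr L ?N (\<lambda>x. x)"
    by (intro distr_cong) (auto simp: sets_eq_imp_space_eq[OF sL(1)] space_PiM coord_perm_inverse[OF f])
  also have "\<dots> = L" using sL(1) by (simp add: distr_id2)
  finally show ?thesis using f L' by metis
qed

end
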